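(* Let $1<q\le 2$, $0<\sigma\le 1$, $0<\nu\le 1$, let $n\ge 1$ be an integer, let $0<\xi<\eta_1<\eta_2<\dots<\eta_n<1$, and let $\alpha_i,\beta_i,\gamma_i\in\mathbb{R}$ ($i=1,\dots,n$). Set $$\Delta_1=\xi^{1-\sigma}\Gamma(2-\nu)-\Gamma(2-\sigma)\sum_{i=1}^n\alpha_i\eta_i^{1-\nu},\qquad \Delta_2=1-\sum_{i=1}^n(\beta_i\eta_i+\gamma_i),\qquad \Delta_3=-2+\sum_{i=1}^n\eta_i(\beta_i\eta_i+2\gamma_i),$$ and assume $\Delta_1\ne 0$ and $\Delta_2\ne 0$. Define $$\Theta=\frac{1}{\Gamma(q+1)}+\frac{1}{|\Delta_2|\Gamma(q+2)}\Big(1+q+\sum_{i=1}^n\eta_i^q\big(\eta_i|\beta_i|+(q+1)|\gamma_i|\big)\Big)+\frac{\Gamma(2-\sigma)\Gamma(2-\nu)\big(|\Delta_3|+2|\Delta_2|\big)}{2|\Delta_1\Delta_2|}\Big(\frac{\xi^{q-\sigma}}{\Gamma(q-\sigma+1)}+\sum_{i=1}^n|\alpha_i|\frac{\eta_i^{q-\nu}}{\Gamma(q-\nu+1)}\Big).$$ Let $f:[0,1]\times\mathbb{R}\to\mathbb{R}$ be continuous, and suppose there is a constant $L>0$ such that $|f(t,x)-f(t,y)|\le L|x-y|$ for all $t\in[0,1]$ and $x,y\in\mathbb{R}$. If $L\,\Theta<1$, then the boundary value problem $${}^{c}D^{q}x(t)=f(t,x(t)),\quad t\in[0,1],$$ $${}^{c}D^{\sigma}x(\xi)=\sum_{i=1}^n\alpha_i\,{}^{c}D^{\nu}x(\eta_i),\qquad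 x(1)=\sum_{i=1}^n\beta_i\int_0^{\eta_i}x(s)\,ds+\sum_{i=1}^n\gamma_i x(\eta_i)$$ has a unique solution on $[0,1]$.
   Context: $\Gamma$ is the Gamma function. For $\mu>0$ and a continuous function $u$ on $[0,1]$, the Riemann-Liouville fractional integral is $I^{\mu}u(t)=\frac{1}{\Gamma(\mu)}\int_0^t (t-s)^{\mu-1}u(s)\,ds$; put $I^0u=u$. ${}^{c}D^{\mu}$ denotes the Caputo fractional derivative of order $\mu$. For $\mu\in(0,1]$ and $x\in C^1[0,1]$, ${}^{c}D^{\mu}x=I^{1-\mu}x'$ (so ${}^{c}D^1x=x'$). For $q\in(1,2]$ and $x\in C^1[0,1]$ such that $z(t):=I^{2-q}\big[x(\cdot)-x(0)-x'(0)\,\cdot\,\big](t)$ belongs to $C^2[0,1]$, ${}^{c}D^{q}x=z''$ (this equals $I^{2-q}x''$ when $x\in C^2[0,1]$, and equals $x''$ when $q=2$). A solution of the boundary value problem is a real function $x\in C^1[0,1]$ for which ${}^{c}D^qx$ exists in this sense, which satisfies the differential equation for all $t\in[0,1]$ and the two boundary conditions. *)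

theory Defs
  imports "HOL-Analysis.Analysis"
begin

(* Functions on [0,1] are represented by total functions real => real of which only the values
   on {0..1} matter. The derivative is therefore taken within {0..1} (one-sided at 0 and 1);
   C1_differentiable_on is not usable here because it demands two-sided derivatives at 0 and 1. *)

definition deriv01 :: "(real \<Rightarrow> real) \<Rightarrow> real \<Rightarrow> real" where
  "deriv01 x t = vector_derivative x (at t within {0..1})"

definition C1_01 :: "(real \<Rightarrow> real) \<Rightarrow> bool" where
  "C1_01 x \<longleftrightarrow> (\<forall>t\<in>{0..1}. x differentiable (at t within {0..1})) \<and> continuous_on {0..1} (deriv01 x)"

definition C2_01 :: "(real \<Rightarrow> real) \<Rightarrow> bool" where
  "C2_01 x \<longleftrightarrow> C1_01 x \<and> C1_01 (deriv01 x)"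

(* Since 0 powr a = 0, the integrand vanishes at s = t also when \<mu> \<le> 1;
   a single point does not affect the integral. *)
definition RL_integral :: "real \<Rightarrow> (real \<Rightarrow> real) \<Rightarrow> real \<Rightarrow> real" where
  "RL_integral \<mu> u t =
     (if \<mu> = 0 then u t
      else 1 / Gamma \<mu> * integral {0..t} (\<lambda>s. (t - s) powr (\<mu> - 1) * u s))"

definition caputo_z :: "real \<Rightarrow> (real \<Rightarrow> real) \<Rightarrow> real \<Rightarrow> real" where
  "caputo_z q x = RL_integral (2 - q) (\<lambda>s. x s - x 0 - deriv01 x 0 * s)"

(* caputo_exists and caputo are meant for orders 0 < \<mu> \<le> 2; caputo \<mu> x is a junk value
   unless caputo_exists \<mu> x. *)
definition caputo_exists :: "real \<Rightarrow> (real \<Rightarrow> real) \<Rightarrow> bool" where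
  "caputo_exists \<mu> x \<longleftrightarrow> C1_01 x \<and> (\<mu> > 1 \<longrightarrow> C2_01 (caputo_z \<mu> x))"

definition caputo :: "real \<Rightarrow> (real \<Rightarrow> real) \<Rightarrow> real \<Rightarrow> real" where
  "caputo \<mu> x =
     (if \<mu> \<le> 1 then RL_integral (1 - \<mu>) (deriv01 x)
      else deriv01 (deriv01 (caputo_z \<mu> x)))"

definition bvp_solution ::
  "real \<Rightarrow> real \<Rightarrow> real \<Rightarrow> real \<Rightarrow> nat \<Rightarrow> (nat \<Rightarrow> real) \<Rightarrow>
   (nat \<Rightarrow> real) \<Rightarrow> (nat \<Rightarrow> real) \<Rightarrow> (nat \<Rightarrow> real) \<Rightarrow> (real \<Rightarrow> real \<Rightarrow> real) \<Rightarrow>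
   (real \<Rightarrow> real) \<Rightarrow> bool" where
  "bvp_solution q \<sigma> \<nu> \<xi> n \<eta> \<alpha> \<beta> \<gamma> f x \<longleftrightarrow>
     C1_01 x \<and> caputo_exists q x \<and>
     (\<forall>t\<in>{0..1}. caputo q x t = f t (x t)) \<and>
     caputo \<sigma> x \<xi> = (\<Sum>i=1..n. \<alpha> i * caputo \<nu> x (\<eta> i)) \<and>
     x 1 = (\<Sum>i=1..n. \<beta> i * integral {0..\<eta> i} x) + (\<Sum>i=1..n. \<gamma> i * x (\<eta> i))"

end

theory Submission
  imports Defs
begin

text \<open>
  Write v(t) = f(t, x(t)). By the semigroup law for Riemann-Liouville integrals, the differential
  equation is equivalent to x(t) = a + b t + I^q v(t): the derivative of I^(2-q) applied to
  x(t) - x(0) - x'(0) t is I^(2-q) (x' - x'(0)) and also I^1 v, and applying I^(q-1) recovers x.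
  Substituting this form into the two boundary conditions gives a triangular linear system for b
  and a whose diagonal entries are multiples of \<open>\<Delta>\<^sub>1\<close> and \<open>\<Delta>\<^sub>2\<close>. So the solutions are the x = S v
  for a linear operator S on C[0,1] of norm at most \<open>\<Theta>\<close>, and \<open>L * \<Theta> < 1\<close> makes x \<open>\<mapsto>\<close> S v a contraction.
\<close>

subsection \<open>Riemann-Liouville integrals of continuous functions\<close>

text \<open>The substitution \<open>s = t * r\<close> reduces this to the Beta integral on the unit
  interval. It divides by \<open>t\<close>, so \<open>t = 0\<close> is separate; there both sides
  vanish because \<open>0 powr _ = 0\<close>.\<close>

lemma has_integral_RL_kernel_powr:
  fixes a c t :: real
  assumes a: "a > 0" and c: "c > -1" and t: "t \<ge> 0"
  shows "((\<lambda>s. (t - s) powr (a - 1) * s powr c) has_integral t powr (a + c) * Beta (c + 1) a) {0..t}"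
proof (cases "t = 0")
  case True
  then show ?thesis by (simp add: has_integral_refl)
next
  case False
  with t have t0: "t > 0" by simp
  have "((\<lambda>r. r powr c * (1 - r) powr (a - 1)) has_integral Beta (c + 1) a) (cbox 0 1)"
    using has_integral_Beta_real[of "c + 1" a] a c by simp
  from has_integral_affinity'[OF this, of "1 / t" 0] t0
  have "((\<lambda>s. (s / t) powr c * (1 - s / t) powr (a - 1)) has_integral t * Beta (c + 1) a) {0..t}"
    by (simp add: field_simps)
  \<comment> \<open>This factor collects \<open>t powr (a - 1)\<close> and \<open>t powr c\<close>,
    which come out of the two rescaled powers.\<close>
  from has_integral_mult_right[OF this, of "t powr (a + c - 1)"]
  have *: "((\<lambda>s. t powr (a + c - 1) * ((s / t) powr c * (1 - s / t) powr (a - 1)))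
          has_integral t powr (a + c - 1) * (t * Beta (c + 1) a)) {0..t}" .
  have **: "t powr (a + c - 1) * (t * Beta (c + 1) a) = t powr (a + c) * Beta (c + 1) a"
    using t0 by (simp add: powr_diff)
  have "(t - s) powr (a - 1) * s powr c = t powr (a + c - 1) * ((s / t) powr c * (1 - s / t) powr (a - 1))"
    if "s \<in> {0..t}" for s
  proof -
    have "1 - s / t = (t - s) / t" using t0 by (simp add: field_simps)
    then show ?thesis
      using t0 that by (simp add: powr_divide powr_diff powr_add)
  qed
  then show ?thesis using *[unfolded **] by (subst has_integral_cong)
qed

lemma RL_integral_cong:
  assumes "t \<ge> 0" and "\<And>s. s \<in> {0..t} \<Longrightarrow> u s = w s"
  shows "RL_integral \<mu> u t = RL_integral \<mu> w t"
proof -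
  have "integral {0..t} (\<lambda>s. (t - s) powr (\<mu> - 1) * u s) = integral {0..t} (\<lambda>s. (t - s) powr (\<mu> - 1) * w s)"
    using assms by (intro integral_cong) auto
  then show ?thesis using assms by (simp add: RL_integral_def)
qed

lemma RL_integral_powr:
  fixes a c t :: real
  assumes a: "a > 0" and c: "c > -1" and t: "t \<ge> 0"
  shows "RL_integral a (\<lambda>s. s powr c) t = Gamma (c + 1) / Gamma (c + 1 + a) * t powr (c + a)"
proof -
  have "Gamma a \<noteq> 0" using Gamma_real_pos[OF a] by simp
  then show ?thesis
    using a integral_unique[OF has_integral_RL_kernel_powr[OF assms]]
    by (simp add: RL_integral_def Beta_def add_ac)
qed

lemma RL_integral_power:
  fixes a t :: real
  assumes a: "a > 0" and t: "t \<ge> 0"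
  shows "RL_integral a (\<lambda>s. s ^ k) t = Gamma (real k + 1) / Gamma (real k + 1 + a) * t powr (real k + a)"
proof -
  \<comment> \<open>For \<open>k = 0\<close> the integrands differ at \<open>s = 0\<close>, since
    \<open>0 ^ 0 = 1\<close> but \<open>0 powr 0 = 0\<close>; one point is negligible.\<close>
  have "integral {0..t} (\<lambda>s. (t - s) powr (a - 1) * s ^ k)
      = integral {0..t} (\<lambda>s. (t - s) powr (a - 1) * s powr real k)"
    by (rule integral_spike[of "{0}"]) (auto simp: powr_realpow)
  then have "RL_integral a (\<lambda>s. s ^ k) t = RL_integral a (\<lambda>s. s powr real k) t"
    using a by (simp add: RL_integral_def)
  then show ?thesis using RL_integral_powr[of a "real k" t] assms by simp
qed

lemma RL_kernel_integrable:
  fixes u :: "real \<Rightarrow> real"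
  assumes "\<mu> > 0" "t \<ge> 0" "continuous_on {0..t} u"
  shows "(\<lambda>s. (t - s) powr (\<mu> - 1) * u s) integrable_on {0..t}"
proof -
  have "((\<lambda>s. (t - s) powr (\<mu> - 1) * s powr 0) has_integral t powr (\<mu> + 0) * Beta (0 + 1) \<mu>) {0..t}"
    using assms by (intro has_integral_RL_kernel_powr) auto
  then have "((\<lambda>s. (t - s) powr (\<mu> - 1)) has_integral t powr (\<mu> + 0) * Beta (0 + 1) \<mu>) {0..t}"
    by (rule has_integral_spike_finite[of "{0}", rotated 2]) auto
  then have "(\<lambda>s. (t - s) powr (\<mu> - 1)) absolutely_integrable_on {0..t}"
    by (intro nonnegative_absolutely_integrable_1) auto
  moreover have "bounded (u ` {0..t})"
    using assms compact_continuous_image compact_imp_bounded by blast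
  ultimately have "(\<lambda>s. u s * (t - s) powr (\<mu> - 1)) absolutely_integrable_on {0..t}"
    using assms by (intro absolutely_integrable_bounded_measurable_product_real
        continuous_imp_measurable_on_sets_lebesgue) auto
  then show ?thesis
    by (simp add: mult.commute set_lebesgue_integral_eq_integral(1))
qed

lemma RL_integral_cmult: "RL_integral \<mu> (\<lambda>s. c * u s) t = c * RL_integral \<mu> u t"
  by (simp add: RL_integral_def mult.left_commute)

lemma RL_integral_add:
  fixes u w :: "real \<Rightarrow> real"
  assumes "\<mu> \<ge> 0" "t \<ge> 0" "continuous_on {0..t} u" "continuous_on {0..t} w"
  shows "RL_integral \<mu> (\<lambda>s. u s + w s) t = RL_integral \<mu> u t + RL_integral \<mu> w t"
  using integral_add[OF RL_kernel_integrable RL_kernel_integrable, of \<mu> t u \<mu> w] assms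
  by (cases "\<mu> = 0") (simp_all add: RL_integral_def algebra_simps)

lemma RL_integral_diff:
  fixes u w :: "real \<Rightarrow> real"
  assumes "\<mu> \<ge> 0" "t \<ge> 0" "continuous_on {0..t} u" "continuous_on {0..t} w"
  shows "RL_integral \<mu> (\<lambda>s. u s - w s) t = RL_integral \<mu> u t - RL_integral \<mu> w t"
  using RL_integral_add[of \<mu> t "\<lambda>s. u s - w s" w] assms by (simp add: continuous_on_diff)

lemma RL_integral_sum:
  fixes g :: "'i \<Rightarrow> real \<Rightarrow> real"
  assumes "\<mu> \<ge> 0" "t \<ge> 0" "finite I" "\<And>i. i \<in> I \<Longrightarrow> continuous_on {0..t} (g i)"
  shows "RL_integral \<mu> (\<lambda>s. \<Sum>i\<in>I. c i * g i s) t = (\<Sum>i\<in>I. c i * RL_integral \<mu> (g i) t)"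
  using assms(3,4)
proof (induction I)
  case empty
  then show ?case by (simp add: RL_integral_def)
next
  case (insert i I)
  then show ?case using assms(1,2)
    by (simp add: RL_integral_add continuous_intros RL_integral_cmult)
qed

lemma RL_integral_one: "RL_integral 1 u t = integral {0..t} u"
proof -
  \<comment> \<open>The kernel is 1 except at \<open>s = t\<close>, where
    \<open>0 powr 0 = 0\<close>.\<close>
  have "integral {0..t} (\<lambda>s. (t - s) powr (1 - 1) * u s) = integral {0..t} u"
    by (rule integral_spike[of "{t}"]) auto
  then show ?thesis by (simp add: RL_integral_def)
qed

lemma RL_integral_bound:
  fixes u :: "real \<Rightarrow> real"
  assumes "\<mu> > 0" "t \<ge> 0" "continuous_on {0..t} u" "\<And>s. s \<in> {0..t} \<Longrightarrow> \<bar>u s\<bar> \<le> M"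
  shows "\<bar>RL_integral \<mu> u t\<bar> \<le> M * (t powr \<mu> / Gamma (\<mu> + 1))"
proof -
  have G: "Gamma \<mu> > 0" using assms(1) by (rule Gamma_real_pos)
  have "norm (integral {0..t} (\<lambda>s. (t - s) powr (\<mu> - 1) * u s))
      \<le> integral {0..t} (\<lambda>s. (t - s) powr (\<mu> - 1) * M)"
    using assms by (intro integral_norm_bound_integral RL_kernel_integrable)
      (auto simp: abs_mult intro!: mult_left_mono)
  \<comment> \<open>The constant bound is written with \<open>s ^ 0\<close> so that the formula for
    monomials evaluates its integral.\<close>
  then have "\<bar>RL_integral \<mu> u t\<bar> \<le> RL_integral \<mu> (\<lambda>s. M * s ^ 0) t"
    using G assms(1) by (simp add: RL_integral_def abs_mult divide_right_mono)
  also have "\<dots> = M * (t powr \<mu> / Gamma (\<mu> + 1))"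
    unfolding RL_integral_cmult using RL_integral_power[OF assms(1,2), of 0]
    by (simp add: add.commute)
  finally show ?thesis .
qed

section \<open>Passage from polynomials to continuous functions\<close>

text \<open>The fractional integral is linear and bounded in the sup norm, with the constant
  \<open>K\<close> below.\<close>

lemma RL_integral_uniform_limit:
  fixes g :: "nat \<Rightarrow> real \<Rightarrow> real"
  assumes \<mu>: "\<mu> \<ge> 0" and g: "\<And>n. continuous_on {0..T} (g n)" and u: "continuous_on {0..T} u"
    and lim: "uniform_limit {0..T} g u sequentially"
  shows "uniform_limit {0..T} (\<lambda>n. RL_integral \<mu> (g n)) (RL_integral \<mu> u) sequentially"
proof (cases "\<mu> = 0")
  case True
  then show ?thesis using lim by (simp add: RL_integral_def[abs_def])
next
  case False
  then have \<mu>0: "\<mu> > 0" using \<mu> by simp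
  define K where "K = T powr \<mu> / Gamma (\<mu> + 1)"
  have G: "Gamma (\<mu> + 1) > 0" using \<mu>0 by (simp add: Gamma_real_pos)
  have K: "K \<ge> 0" using G by (simp add: K_def)
  show ?thesis
  proof (rule uniform_limitI)
    fix e :: real assume e: "e > 0"
    \<comment> \<open>\<open>K + 1\<close> replaces \<open>K\<close> because \<open>K\<close> may be
      0; it also makes the final inequality strict.\<close>
    have "e / (K + 1) > 0" using e K by simp
    from uniform_limitD[OF lim this]
    show "\<forall>\<^sub>F n in sequentially. \<forall>t\<in>{0..T}. dist (RL_integral \<mu> (g n) t) (RL_integral \<mu> u t) < e"
    proof (rule eventually_mono, intro ballI)
      fix n t assume *: "\<forall>t\<in>{0..T}. dist (g n t) (u t) < e / (K + 1)" and t: "t \<in> {0..T}"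
      have c: "continuous_on {0..t} (g n)" "continuous_on {0..t} u"
        using t by (auto intro: continuous_on_subset[OF g] continuous_on_subset[OF u])
      have "\<bar>RL_integral \<mu> (\<lambda>s. g n s - u s) t\<bar> \<le> e / (K + 1) * (t powr \<mu> / Gamma (\<mu> + 1))"
        using * t c \<mu>0 by (intro RL_integral_bound continuous_intros)
          (auto simp: dist_real_def intro!: less_imp_le)
      also have "\<dots> \<le> e / (K + 1) * K"
        unfolding K_def using t \<mu>0 G e K[unfolded K_def]
        by (intro mult_left_mono divide_right_mono powr_mono2) auto
      also have "\<dots> < e" using e K by (simp add: field_simps)
      finally show "dist (RL_integral \<mu> (g n) t) (RL_integral \<mu> u t) < e"
        using RL_integral_diff[of \<mu> t "g n" u] \<mu> t c by (simp add: dist_real_def)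
    qed
  qed
qed

text \<open>Stone-Weierstrass with explicit coefficients, so that fractional integrals can be
  computed monomial by monomial.\<close>

lemma polynomial_approximation_sequence:
  fixes u :: "real \<Rightarrow> real"
  assumes "continuous_on {a..b} u"
  obtains c :: "nat \<Rightarrow> nat \<Rightarrow> real" and d :: "nat \<Rightarrow> nat"
  where "uniform_limit {a..b} (\<lambda>n x. \<Sum>i\<le>d n. c n i * x ^ i) u sequentially"
proof -
  have "\<exists>g. uniform_limit {a..b} g u sequentially \<and> (\<forall>n. polynomial_function (g n))"
    using Stone_Weierstrass_uniform_limit[OF compact_Icc assms] by metis
  then obtain g where lim: "uniform_limit {a..b} g u sequentially"
    and g: "\<And>n. polynomial_function (g n)" by blast
  have "\<forall>n. \<exists>c d. g n = (\<lambda>x. \<Sum>i\<le>d. c i * x ^ i)"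
    using g by (simp add: real_polynomial_function_eq[symmetric] real_polynomial_function_iff_sum)
  then obtain c d where "\<And>n. g n = (\<lambda>x. \<Sum>i\<le>d n. c n i * x ^ i)" by metis
  then have "g = (\<lambda>n x. \<Sum>i\<le>d n. c n i * x ^ i)" by auto
  with lim that show ?thesis by blast
qed

lemma RL_integral_polynomial:
  assumes "\<mu> > 0" "t \<ge> 0"
  shows "RL_integral \<mu> (\<lambda>x. \<Sum>i\<le>d. c i * x ^ i) t
    = (\<Sum>i\<le>d. c i * (Gamma (real i + 1) / Gamma (real i + 1 + \<mu>)) * t powr (real i + \<mu>))"
  using assms by (subst RL_integral_sum) (auto simp: RL_integral_power mult.assoc intro!: continuous_intros)

text \<open>A positive exponent matters: \<open>t powr 0\<close> jumps from 0 at
  \<open>t = 0\<close> to 1.\<close>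

lemma continuous_on_powr_right:
  fixes c :: real
  assumes "c > 0"
  shows "continuous_on {0..T} (\<lambda>t. t powr c)"
  using assms by (intro continuous_on_powr') (auto intro!: continuous_intros)

text \<open>Fractional integrals of polynomials are sums of powers with positive exponents, hence
  continuous, and they converge uniformly. This replaces an estimate of how the singular kernel
  varies with \<open>t\<close>.\<close>

lemma continuous_on_RL_integral:
  fixes u :: "real \<Rightarrow> real"
  assumes \<mu>: "\<mu> \<ge> 0" and u: "continuous_on {0..T} u"
  shows "continuous_on {0..T} (RL_integral \<mu> u)"
proof (cases "\<mu> = 0")
  case True
  then show ?thesis using u by (simp add: RL_integral_def[abs_def])
next
  case False
  then have \<mu>0: "\<mu> > 0" using \<mu> by simp
  from u obtain c :: "nat \<Rightarrow> nat \<Rightarrow> real" and d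
    where lim: "uniform_limit {0..T} (\<lambda>n x. \<Sum>i\<le>d n. c n i * x ^ i) u sequentially"
    by (rule polynomial_approximation_sequence)
  have lim': "uniform_limit {0..T} (\<lambda>n. RL_integral \<mu> (\<lambda>x. \<Sum>i\<le>d n. c n i * x ^ i)) (RL_integral \<mu> u) sequentially"
    by (rule RL_integral_uniform_limit[OF \<mu> _ u lim]) (intro continuous_intros)
  have "continuous_on {0..T} (RL_integral \<mu> (\<lambda>x. \<Sum>i\<le>d n. c n i * x ^ i))" for n
  proof -
    have "continuous_on {0..T} (\<lambda>t. \<Sum>i\<le>d n. c n i * (Gamma (real i + 1) / Gamma (real i + 1 + \<mu>)) * t powr (real i + \<mu>))"
      using \<mu>0 by (intro continuous_intros continuous_on_powr_right) auto
    then show ?thesis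
      using \<mu>0 by (subst continuous_on_cong[OF refl RL_integral_polynomial]) auto
  qed
  then show ?thesis
    by (intro uniform_limit_theorem[OF _ lim'] always_eventually) auto
qed

text \<open>On monomials the semigroup law is the telescoping of the Gamma quotients;
  uniform approximation by polynomials extends it without exchanging integrals.\<close>

lemma RL_integral_semigroup:
  fixes u :: "real \<Rightarrow> real"
  assumes a: "a \<ge> 0" and b: "b \<ge> 0" and u: "continuous_on {0..T} u" and t: "t \<in> {0..T}"
  shows "RL_integral a (RL_integral b u) t = RL_integral (a + b) u t"
proof (cases "a = 0 \<or> b = 0")
  case True
  then show ?thesis by (auto simp: RL_integral_def[abs_def])
next
  case False
  then have ab: "a > 0" "b > 0" using a b by auto
  from u obtain c :: "nat \<Rightarrow> nat \<Rightarrow> real" and d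
    where lim: "uniform_limit {0..T} (\<lambda>n x. \<Sum>i\<le>d n. c n i * x ^ i) u sequentially"
    by (rule polynomial_approximation_sequence)
  define p where "p n x = (\<Sum>i\<le>d n. c n i * x ^ i)" for n x
  have p: "continuous_on {0..T} (p n)" for n
    unfolding p_def by (intro continuous_intros)
  have lim: "uniform_limit {0..T} p u sequentially"
    using lim unfolding p_def .
  have "uniform_limit {0..T} (\<lambda>n. RL_integral a (RL_integral b (p n))) (RL_integral a (RL_integral b u)) sequentially"
    using a b u p lim by (intro RL_integral_uniform_limit continuous_on_RL_integral) auto
  then have 1: "(\<lambda>n. RL_integral a (RL_integral b (p n)) t) \<longlonglongrightarrow> RL_integral a (RL_integral b u) t"
    using t by (rule tendsto_uniform_limitI)
  have "uniform_limit {0..T} (\<lambda>n. RL_integral (a + b) (p n)) (RL_integral (a + b) u) sequentially"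
    using a b u p lim by (intro RL_integral_uniform_limit) auto
  then have 2: "(\<lambda>n. RL_integral (a + b) (p n) t) \<longlonglongrightarrow> RL_integral (a + b) u t"
    using t by (rule tendsto_uniform_limitI)
  have "RL_integral a (RL_integral b (p n)) t = RL_integral (a + b) (p n) t" for n
  proof -
    have "RL_integral a (RL_integral b (p n)) t
        = RL_integral a (\<lambda>s. \<Sum>i\<le>d n. c n i * (Gamma (real i + 1) / Gamma (real i + 1 + b)) * s powr (real i + b)) t"
      using t ab unfolding p_def by (intro RL_integral_cong RL_integral_polynomial) auto
    also have "\<dots> = (\<Sum>i\<le>d n. c n i * (Gamma (real i + 1) / Gamma (real i + 1 + b))
        * RL_integral a (\<lambda>s. s powr (real i + b)) t)"
      using t ab by (intro RL_integral_sum continuous_on_powr_right) auto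
    also have "\<dots> = RL_integral (a + b) (p n) t"
      unfolding p_def using t ab
    proof (subst RL_integral_polynomial, goal_cases)
      case 3
      show ?case
      proof (rule sum.cong)
        fix i
        \<comment> \<open>This Gamma value is the denominator produced by the inner integral and the
          numerator produced by the outer one; being nonzero, it cancels.\<close>
        have "Gamma (1 + (b + real i)) \<noteq> 0"
          using Gamma_real_pos[of "1 + (b + real i)"] ab by linarith
        then show "c n i * (Gamma (real i + 1) / Gamma (real i + 1 + b)) * RL_integral a (\<lambda>s. s powr (real i + b)) t
          = c n i * (Gamma (real i + 1) / Gamma (real i + 1 + (a + b))) * t powr (real i + (a + b))"
          using t ab by (subst RL_integral_powr) (auto simp: add_ac)
      qed simp
    qed auto
    finally show ?thesis .
  qed
  with 1 2 show ?thesis by (simp add: LIMSEQ_unique)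
qed

subsection \<open>Caputo derivatives on the unit interval\<close>

lemma deriv01_eqI:
  assumes "t \<in> {0..1}" "(x has_vector_derivative d) (at t within {0..1})"
  shows "deriv01 x t = d"
  using vector_derivative_within_cbox[of 0 1 t x d] assms by (simp add: deriv01_def)

lemma C1_01I:
  assumes "\<And>t. t \<in> {0..1} \<Longrightarrow> (x has_vector_derivative d t) (at t within {0..1})"
    and "continuous_on {0..1} d"
  shows "C1_01 x"
proof -
  have "continuous_on {0..1} (deriv01 x)"
    using assms deriv01_eqI by (subst continuous_on_cong[OF refl, of _ _ d]) auto
  then show ?thesis
    using assms(1) unfolding C1_01_def has_vector_derivative_def differentiable_def by blast
qed

lemma C1_01_has_vector_derivative:
  assumes "C1_01 x" "t \<in> {0..1}"
  shows "(x has_vector_derivative deriv01 x t) (at t within {0..1})"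
  using assms vector_derivative_works unfolding C1_01_def deriv01_def by blast

lemma C1_01_imp_continuous_on: "C1_01 x \<Longrightarrow> continuous_on {0..1} x"
  by (auto simp: C1_01_def intro!: differentiable_imp_continuous_on simp: differentiable_on_def)

text \<open>The fundamental theorem of calculus, phrased with order 1 so that the semigroup law can
  be applied to it.\<close>

lemma C1_01_eq_RL_integral_deriv01:
  assumes "C1_01 x" "t \<in> {0..1}"
  shows "x t = x 0 + RL_integral 1 (deriv01 x) t"
proof -
  have "(deriv01 x has_integral x t - x 0) {0..t}"
    using assms
    by (intro fundamental_theorem_of_calculus has_vector_derivative_within_subset[OF C1_01_has_vector_derivative]) auto
  then show ?thesis by (simp add: RL_integral_one integral_unique)
qed

lemma C2_01I:
  assumes z: "\<And>t. t \<in> {0..1} \<Longrightarrow> (z has_vector_derivative z' t) (at t within {0..1})"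
    and z': "\<And>t. t \<in> {0..1} \<Longrightarrow> (z' has_vector_derivative z'' t) (at t within {0..1})"
    and "continuous_on {0..1} z''"
  shows "C2_01 z" and "\<And>t. t \<in> {0..1} \<Longrightarrow> deriv01 (deriv01 z) t = z'' t"
proof -
  have d: "deriv01 z t = z' t" if "t \<in> {0..1}" for t
    by (rule deriv01_eqI[OF that z[OF that]])
  have d': "(deriv01 z has_vector_derivative z'' t) (at t within {0..1})" if "t \<in> {0..1}" for t
    by (rule has_vector_derivative_transform[OF that d z'[OF that]])
  have "C1_01 z'" by (rule C1_01I) (use assms in auto)
  then have "C1_01 z" by (intro C1_01I[OF z] C1_01_imp_continuous_on)
  moreover have "C1_01 (deriv01 z)" by (rule C1_01I) (use assms d' in auto)
  ultimately show "C2_01 z" by (simp add: C2_01_def)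
  show "deriv01 (deriv01 z) t = z'' t" if "t \<in> {0..1}" for t
    by (rule deriv01_eqI[OF that d'[OF that]])
qed

lemma RL_integral_at_0: "\<mu> \<noteq> 0 \<Longrightarrow> RL_integral \<mu> u 0 = 0"
  by (simp add: RL_integral_def)

text \<open>By the semigroup law the integral of order \<open>\<mu>\<close> is an ordinary integral
  of the one of order \<open>\<mu> - 1\<close>, which is continuous. For \<open>\<mu> = 1\<close>
  the derivative is \<open>u\<close> itself, by the convention for order 0.\<close>

lemma RL_integral_has_vector_derivative:
  fixes u :: "real \<Rightarrow> real"
  assumes \<mu>: "\<mu> \<ge> 1" and u: "continuous_on {0..T} u" and t: "t \<in> {0..T}"
  shows "(RL_integral \<mu> u has_vector_derivative RL_integral (\<mu> - 1) u t) (at t within {0..T})"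
proof (rule has_vector_derivative_transform)
  show "t \<in> {0..T}" by fact
  show "RL_integral \<mu> u s = integral {0..s} (RL_integral (\<mu> - 1) u)" if "s \<in> {0..T}" for s
    using RL_integral_semigroup[of 1 "\<mu> - 1" T u s] \<mu> u that by (simp add: RL_integral_one)
  show "((\<lambda>s. integral {0..s} (RL_integral (\<mu> - 1) u)) has_vector_derivative
      RL_integral (\<mu> - 1) u t) (at t within {0..T})"
    using \<mu> u t by (intro integral_has_vector_derivative continuous_on_RL_integral) auto
qed

lemma affine_plus_RL_integral_has_vector_derivative:
  fixes v :: "real \<Rightarrow> real"
  assumes q: "1 < q" and v: "continuous_on {0..1} v"
    and x: "\<And>t. t \<in> {0..1} \<Longrightarrow> x t = a + b * t + RL_integral q v t" and t: "t \<in> {0..1}"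
  shows "(x has_vector_derivative b + RL_integral (q - 1) v t) (at t within {0..1})"
proof (rule has_vector_derivative_transform[OF t x])
  have "((\<lambda>s. a + b * s) has_vector_derivative b) (at t within {0..1})"
    by (auto intro!: derivative_eq_intros simp flip: has_real_derivative_iff_has_vector_derivative)
  then show "((\<lambda>s. a + b * s + RL_integral q v s) has_vector_derivative b + RL_integral (q - 1) v t) (at t within {0..1})"
    using q v t by (intro has_vector_derivative_add RL_integral_has_vector_derivative) auto
qed

text \<open>The right-hand side is a fixed continuous \<open>v\<close>, so only linear theory is
  involved; the nonlinearity is substituted later.\<close>

lemma caputo_equation_iff:
  fixes v :: "real \<Rightarrow> real"
  assumes q: "1 < q" "q \<le> 2" and v: "continuous_on {0..1} v"
  shows "caputo_exists q x \<and> (\<forall>t\<in>{0..1}. caputo q x t = v t)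
    \<longleftrightarrow> (\<exists>a b. \<forall>t\<in>{0..1}. x t = a + b * t + RL_integral q v t)" (is "?lhs \<longleftrightarrow> ?rhs")
proof
  assume ?lhs
  then have C1: "C1_01 x" and C2: "C2_01 (caputo_z q x)"
    and eq: "\<And>t. t \<in> {0..1} \<Longrightarrow> deriv01 (deriv01 (caputo_z q x)) t = v t"
    using q by (auto simp: caputo_exists_def caputo_def)
  define b where "b = deriv01 x 0"
  \<comment> \<open>Subtracting the initial slope makes the shifted function inside
    \<open>caputo_z\<close> equal to the ordinary integral of \<open>w\<close>.\<close>
  define w where "w s = deriv01 x s - b" for s
  have cx: "continuous_on {0..1} (deriv01 x)" using C1 by (simp add: C1_01_def)
  then have cw: "continuous_on {0..1} w" unfolding w_def by (intro continuous_intros)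
  have y: "x s - x 0 - b * s = RL_integral 1 w s" if "s \<in> {0..1}" for s
  proof -
    have c: "continuous_on {0..s} (deriv01 x)"
      using that by (intro continuous_on_subset[OF cx]) auto
    have "RL_integral 1 w s = RL_integral 1 (deriv01 x) s - RL_integral 1 (\<lambda>_. b) s"
      unfolding w_def using that c by (subst RL_integral_diff) auto
    also have "\<dots> = x s - x 0 - b * s"
      using C1_01_eq_RL_integral_deriv01[OF C1 that] that by (simp add: RL_integral_one)
    finally show ?thesis by simp
  qed
  have z: "caputo_z q x t = RL_integral (3 - q) w t" if "t \<in> {0..1}" for t
  proof -
    have "caputo_z q x t = RL_integral (2 - q) (RL_integral 1 w) t"
      unfolding caputo_z_def b_def[symmetric] using that y by (intro RL_integral_cong) auto
    also have "\<dots> = RL_integral (2 - q + 1) w t"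
      using q cw that by (intro RL_integral_semigroup) auto
    finally show ?thesis by simp
  qed
  \<comment> \<open>Since \<open>q \<le> 2\<close>, the order \<open>3 - q\<close> is at least 1 and
    differentiation lowers it by one.\<close>
  have z': "deriv01 (caputo_z q x) t = RL_integral (2 - q) w t" if t: "t \<in> {0..1}" for t
    using RL_integral_has_vector_derivative[of "3 - q" 1 w t] q cw t
    by (intro deriv01_eqI[OF t has_vector_derivative_transform[OF t z]]) auto
  \<comment> \<open>For \<open>q < 2\<close> the integral is over a single point; for
    \<open>q = 2\<close> the value is \<open>w 0\<close>, which is 0 by the choice of
    \<open>b\<close>. So integrating the second derivative of \<open>caputo_z q x\<close> adds no
    constant.\<close>
  have "RL_integral (2 - q) w 0 = 0"
    by (simp add: RL_integral_def w_def b_def)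
  with z' have z'0: "deriv01 (caputo_z q x) 0 = 0" by simp
  have key: "RL_integral (2 - q) w t = RL_integral 1 v t" if t: "t \<in> {0..1}" for t
  proof -
    have "deriv01 (caputo_z q x) t = RL_integral 1 (deriv01 (deriv01 (caputo_z q x))) t"
      using C1_01_eq_RL_integral_deriv01[of "deriv01 (caputo_z q x)" t] C2 t z'0
      by (simp add: C2_01_def)
    also have "\<dots> = RL_integral 1 v t"
      using t eq by (intro RL_integral_cong) auto
    finally show ?thesis using z' t by simp
  qed
  \<comment> \<open>Integrating \<open>key\<close> once more with order \<open>q - 1\<close> raises
    the orders \<open>2 - q\<close> and 1 to 1 and \<open>q\<close>.\<close>
  have w: "RL_integral 1 w t = RL_integral q v t" if t: "t \<in> {0..1}" for t
  proof -
    have "RL_integral 1 w t = RL_integral (q - 1) (RL_integral (2 - q) w) t"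
      using RL_integral_semigroup[of "q - 1" "2 - q" 1 w t] q cw t by simp
    also have "\<dots> = RL_integral (q - 1) (RL_integral 1 v) t"
      using t key by (intro RL_integral_cong) auto
    also have "\<dots> = RL_integral q v t"
      using RL_integral_semigroup[of "q - 1" 1 1 v t] q v t by simp
    finally show ?thesis .
  qed
  have "x t = x 0 + b * t + RL_integral q v t" if t: "t \<in> {0..1}" for t
    using y[OF t] w[OF t] by linarith
  then show ?rhs by blast
next
  assume ?rhs
  then obtain a b where x: "\<And>t. t \<in> {0..1} \<Longrightarrow> x t = a + b * t + RL_integral q v t" by blast
  have d: "(x has_vector_derivative b + RL_integral (q - 1) v t) (at t within {0..1})"
    if "t \<in> {0..1}" for t
    using affine_plus_RL_integral_has_vector_derivative[OF q(1) v x that] .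
  have C1: "C1_01 x"
    using q v by (intro C1_01I[OF d] continuous_intros continuous_on_RL_integral) auto
  \<comment> \<open>The integrals of orders \<open>q\<close> and \<open>q - 1\<close> vanish at 0,
    so \<open>a\<close> and \<open>b\<close> are exactly the Taylor coefficients that
    \<open>caputo_z\<close> subtracts. What remains is the integral of \<open>v\<close> of order 2,
    which is differentiated twice.\<close>
  have x0: "x 0 = a" using x[of 0] q by (simp add: RL_integral_at_0)
  have x'0: "deriv01 x 0 = b" using deriv01_eqI[OF _ d, of 0] q by (simp add: RL_integral_at_0)
  have z: "caputo_z q x t = RL_integral 2 v t" if t: "t \<in> {0..1}" for t
  proof -
    have "caputo_z q x t = RL_integral (2 - q) (RL_integral q v) t"
      unfolding caputo_z_def using t by (intro RL_integral_cong) (auto simp: x x0 x'0)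
    also have "\<dots> = RL_integral 2 v t"
      using RL_integral_semigroup[of "2 - q" q 1 v t] q v t by simp
    finally show ?thesis .
  qed
  have z': "(caputo_z q x has_vector_derivative RL_integral 1 v t) (at t within {0..1})" if t: "t \<in> {0..1}" for t
    using RL_integral_has_vector_derivative[of 2 1 v t] v t
    by (intro has_vector_derivative_transform[OF t z]) auto
  have z'': "(RL_integral 1 v has_vector_derivative v t) (at t within {0..1})" if t: "t \<in> {0..1}" for t
    using RL_integral_has_vector_derivative[of 1 1 v t] v t by (simp add: RL_integral_def[of 0])
  show ?lhs
    using C1 C2_01I[OF z' z'' v] q by (simp add: caputo_exists_def caputo_def)
qed

text \<open>Here \<open>x'\<close> is \<open>b\<close> plus the integral of \<open>v\<close> of
  order \<open>q - 1\<close>, and the orders \<open>1 - \<mu>\<close> and \<open>q - 1\<close> add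
  up to \<open>q - \<mu>\<close>. The point 0 is excluded: for \<open>\<mu> = 1\<close> the left
  side there is \<open>b\<close>, whereas \<open>0 powr 0 = 0\<close>.\<close>

lemma caputo_affine_plus_RL_integral:
  fixes v :: "real \<Rightarrow> real"
  assumes q: "1 < q" and \<mu>: "0 < \<mu>" "\<mu> \<le> 1" and v: "continuous_on {0..1} v"
    and x: "\<And>t. t \<in> {0..1} \<Longrightarrow> x t = a + b * t + RL_integral q v t" and t: "t \<in> {0<..1}"
  shows "caputo \<mu> x t = b * (t powr (1 - \<mu>) / Gamma (2 - \<mu>)) + RL_integral (q - \<mu>) v t"
proof -
  have t': "t \<in> {0..1}" using t by simp
  have d: "deriv01 x s = b + RL_integral (q - 1) v s" if "s \<in> {0..1}" for s
    by (rule deriv01_eqI[OF that affine_plus_RL_integral_has_vector_derivative[OF q v x that]])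
  have "caputo \<mu> x t = RL_integral (1 - \<mu>) (\<lambda>s. b * s ^ 0 + RL_integral (q - 1) v s) t"
    unfolding caputo_def using \<mu> t d by (auto intro!: RL_integral_cong)
  also have "\<dots> = b * RL_integral (1 - \<mu>) (\<lambda>s. s ^ 0) t + RL_integral (1 - \<mu>) (RL_integral (q - 1) v) t"
    unfolding RL_integral_cmult[symmetric] using q \<mu> t
    by (intro RL_integral_add continuous_intros continuous_on_RL_integral continuous_on_subset[OF v]) auto
  also have "RL_integral (1 - \<mu>) (RL_integral (q - 1) v) t = RL_integral (q - \<mu>) v t"
    using RL_integral_semigroup[of "1 - \<mu>" "q - 1" 1 v t] q \<mu> v t' by simp
  also have "RL_integral (1 - \<mu>) (\<lambda>s. s ^ 0) t = t powr (1 - \<mu>) / Gamma (2 - \<mu>)"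
  proof (cases "\<mu> = 1")
    case True
    then show ?thesis using t by (simp add: RL_integral_def)
  next
    case False
    then show ?thesis using RL_integral_power[of "1 - \<mu>" t 0] \<mu> t by simp
  qed
  finally show ?thesis .
qed

lemma integral_affine_plus_RL_integral:
  fixes v :: "real \<Rightarrow> real"
  assumes q: "0 \<le> q" and v: "continuous_on {0..1} v"
    and x: "\<And>t. t \<in> {0..1} \<Longrightarrow> x t = a + b * t + RL_integral q v t" and t: "t \<in> {0..1}"
  shows "integral {0..t} x = a * t + b * (t\<^sup>2 / 2) + RL_integral (q + 1) v t"
proof -
  have c: "continuous_on {0..t} (RL_integral q v)"
    using q t by (intro continuous_on_RL_integral continuous_on_subset[OF v]) auto
  have r: "integral {0..t} (RL_integral q v) = RL_integral (q + 1) v t"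
    using RL_integral_semigroup[of 1 q 1 v t] q v t by (simp add: RL_integral_one add.commute)
  have "((\<lambda>s. a + b * s + RL_integral q v s) has_integral
      measure lborel {0..t} *\<^sub>R a + b * ((t\<^sup>2 - 0\<^sup>2) / 2) + RL_integral (q + 1) v t) {0..t}"
    unfolding r[symmetric] using t c
    by (intro has_integral_add has_integral_mult_right ident_has_integral
        has_integral_const_real[of a 0 t]
        integrable_integral integrable_continuous_real) auto
  then have "(x has_integral measure lborel {0..t} *\<^sub>R a + b * ((t\<^sup>2 - 0\<^sup>2) / 2) + RL_integral (q + 1) v t) {0..t}"
    using x t by (subst has_integral_cong[of _ _ "\<lambda>s. a + b * s + RL_integral q v s"]) auto
  then show ?thesis using t by (simp add: integral_unique mult.commute)
qed

subsection \<open>A fixed-point theorem in C[a,b]\<close>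

text \<open>Banach's theorem is applied in the complete space of bounded continuous functions on the
  real line, to which \<open>T u\<close> is carried by clamping the argument to
  \<open>{a..b}\<close>. The bound \<open>M\<close> in the hypothesis plays the role of the sup
  distance on \<open>{a..b}\<close>.\<close>

lemma contraction_on_continuous_functions_Icc:
  fixes T :: "(real \<Rightarrow> real) \<Rightarrow> real \<Rightarrow> real"
  assumes ab: "a \<le> b" and k: "0 \<le> k" "k < 1"
    and cont: "\<And>u. continuous_on {a..b} u \<Longrightarrow> continuous_on {a..b} (T u)"
    and contr: "\<And>u w M t. continuous_on {a..b} u \<Longrightarrow> continuous_on {a..b} w \<Longrightarrow>
      (\<And>s. s \<in> {a..b} \<Longrightarrow> \<bar>u s - w s\<bar> \<le> M) \<Longrightarrow> t \<in> {a..b} \<Longrightarrow> \<bar>T u t - T w t\<bar> \<le> k * M"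
  obtains x where "continuous_on {a..b} x" "\<And>t. t \<in> {a..b} \<Longrightarrow> x t = T x t"
    "\<And>y t. continuous_on {a..b} y \<Longrightarrow> (\<And>t. t \<in> {a..b} \<Longrightarrow> y t = T y t) \<Longrightarrow> t \<in> {a..b} \<Longrightarrow> y t = x t"
proof -
  define c where "c t = max a (min b t)" for t
  have c: "c t \<in> {a..b}" for t using ab by (auto simp: c_def)
  have cc: "continuous_on UNIV c" unfolding c_def by (intro continuous_intros)
  define \<Phi> :: "(real \<Rightarrow>\<^sub>C real) \<Rightarrow> (real \<Rightarrow>\<^sub>C real)" where "\<Phi> u = Bcontfun (\<lambda>t. T u (c t))" for u
  have \<Phi>: "apply_bcontfun (\<Phi> u) t = T u (c t)" for u t
  proof -
    have Tu: "continuous_on {a..b} (T u)" by (intro cont) auto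
    then have "continuous_on UNIV (\<lambda>t. T u (c t))"
      by (rule continuous_on_compose2[OF _ cc]) (use c in auto)
    moreover have "bounded (T u ` {a..b})"
      using Tu compact_continuous_image compact_imp_bounded by blast
    then have "bounded (range (\<lambda>t. T u (c t)))"
      by (rule bounded_subset) (use c in auto)
    ultimately show ?thesis
      unfolding \<Phi>_def by (subst Bcontfun_inverse) (auto simp: bcontfun_def)
  qed
  have "dist (\<Phi> u) (\<Phi> w) \<le> k * dist u w" for u w
  proof (rule dist_bound)
    fix t
    have "\<bar>T u (c t) - T w (c t)\<bar> \<le> k * dist u w"
      using c dist_bounded[of u _ w] by (intro contr) (auto simp: dist_real_def)
    then show "dist (apply_bcontfun (\<Phi> u) t) (apply_bcontfun (\<Phi> w) t) \<le> k * dist u w"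
      by (simp add: \<Phi> dist_real_def)
  qed
  then have "\<exists>!u. \<Phi> u = u" using k by (intro banach_fix_type) auto
  then obtain u where u: "\<Phi> u = u" by blast
  have cu: "continuous_on {a..b} (apply_bcontfun u)" by simp
  have fu: "apply_bcontfun u t = T u t" if "t \<in> {a..b}" for t
    using \<Phi>[of u t] that by (simp add: u c_def)
  show ?thesis
  proof (rule that[OF cu fu])
    fix y t assume y: "continuous_on {a..b} y" "\<And>t. t \<in> {a..b} \<Longrightarrow> y t = T y t" and t: "t \<in> {a..b}"
    \<comment> \<open>Outside \<open>{a..b}\<close> nothing is known of \<open>y\<close>, so it need
      not lie in the Banach space. Uniqueness comes instead from a point \<open>m\<close> of maximal
      distance: the contraction bounds that distance by \<open>k < 1\<close> times itself.\<close>
    have "continuous_on {a..b} (\<lambda>s. \<bar>y s - apply_bcontfun u s\<bar>)"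
      using y by (intro continuous_intros) auto
    from continuous_attains_sup[OF compact_Icc _ this] t obtain m where m: "m \<in> {a..b}"
      "\<And>s. s \<in> {a..b} \<Longrightarrow> \<bar>y s - apply_bcontfun u s\<bar> \<le> \<bar>y m - apply_bcontfun u m\<bar>" by auto
    have "\<bar>T y m - T u m\<bar> \<le> k * \<bar>y m - apply_bcontfun u m\<bar>"
      using m by (intro contr y cu) auto
    then have "(1 - k) * \<bar>y m - apply_bcontfun u m\<bar> \<le> 0"
      using y(2) fu m(1) by (simp add: algebra_simps)
    then have "\<bar>y m - apply_bcontfun u m\<bar> \<le> 0"
      using k by (simp add: mult_le_0_iff)
    with m(2)[OF t] show "y t = apply_bcontfun u t" by simp
  qed
qed

subsection \<open>The boundary value problem\<close>

lemma continuous_on_superposition: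
  assumes f: "continuous_on (S \<times> UNIV) (\<lambda>(t, x). f t x)" and u: "continuous_on S u"
  shows "continuous_on S (\<lambda>s. f s (u s))"
proof -
  have "continuous_on S (\<lambda>s. (\<lambda>(t, x). f t x) (s, u s))"
    by (rule continuous_on_compose2[OF f]) (auto intro!: continuous_intros u)
  then show ?thesis by simp
qed

text \<open>The data of the linear problem, kept apart from \<open>f\<close>. The nodes are taken in
  \<open>{0<..1}\<close> because the formula for their Caputo derivatives excludes 0.\<close>

locale multipoint_bvp =
  fixes q \<sigma> \<nu> \<xi> \<Delta>\<^sub>1 \<Delta>\<^sub>2 \<Delta>\<^sub>3 \<Theta> :: real
    and n :: nat
    and \<eta> \<alpha> \<beta> \<gamma> :: "nat \<Rightarrow> real"
  assumes q: "1 < q" "q \<le> 2"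
    and \<sigma>: "0 < \<sigma>" "\<sigma> \<le> 1"
    and \<nu>: "0 < \<nu>" "\<nu> \<le> 1"
    and \<xi>: "\<xi> \<in> {0<..1}"
    and \<eta>: "\<And>i. i \<in> {1..n} \<Longrightarrow> \<eta> i \<in> {0<..1}"
    and \<Delta>\<^sub>1: "\<Delta>\<^sub>1 = \<xi> powr (1 - \<sigma>) * Gamma (2 - \<nu>)
               - Gamma (2 - \<sigma>) * (\<Sum>i=1..n. \<alpha> i * \<eta> i powr (1 - \<nu>))"
    and \<Delta>\<^sub>2: "\<Delta>\<^sub>2 = 1 - (\<Sum>i=1..n. \<beta> i * \<eta> i + \<gamma> i)"
    and \<Delta>\<^sub>3: "\<Delta>\<^sub>3 = - 2 + (\<Sum>i=1..n. \<eta> i * (\<beta> i * \<eta> i + 2 * \<gamma> i))"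
    and nz: "\<Delta>\<^sub>1 \<noteq> 0" "\<Delta>\<^sub>2 \<noteq> 0"
    and \<Theta>: "\<Theta> = 1 / Gamma (q + 1)
        + 1 / (\<bar>\<Delta>\<^sub>2\<bar> * Gamma (q + 2))
          * (1 + q + (\<Sum>i=1..n. \<eta> i powr q * (\<eta> i * \<bar>\<beta> i\<bar> + (q + 1) * \<bar>\<gamma> i\<bar>)))
        + Gamma (2 - \<sigma>) * Gamma (2 - \<nu>) * (\<bar>\<Delta>\<^sub>3\<bar> + 2 * \<bar>\<Delta>\<^sub>2\<bar>) / (2 * \<bar>\<Delta>\<^sub>1 * \<Delta>\<^sub>2\<bar>)
          * (\<xi> powr (q - \<sigma>) / Gamma (q - \<sigma> + 1)
             + (\<Sum>i=1..n. \<bar>\<alpha> i\<bar> * (\<eta> i powr (q - \<nu>) / Gamma (q - \<nu> + 1))))"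
begin

section \<open>The solution operator of the linear problem\<close>

text \<open>Right side minus left side of the first boundary condition for the particular solution
  \<open>RL_integral q v\<close>; \<open>endpoint_defect\<close> is the same for the second
  condition.\<close>

definition caputo_defect :: "(real \<Rightarrow> real) \<Rightarrow> real" where
  "caputo_defect v = (\<Sum>i=1..n. \<alpha> i * RL_integral (q - \<nu>) v (\<eta> i)) - RL_integral (q - \<sigma>) v \<xi>"

definition endpoint_defect :: "(real \<Rightarrow> real) \<Rightarrow> real" where
  "endpoint_defect v = (\<Sum>i=1..n. \<beta> i * RL_integral (q + 1) v (\<eta> i) + \<gamma> i * RL_integral q v (\<eta> i))
     - RL_integral q v 1"

definition slope :: "(real \<Rightarrow> real) \<Rightarrow> real" where
  "slope v = Gamma (2 - \<sigma>) * Gamma (2 - \<nu>) / \<Delta>\<^sub>1 * caputo_defect v"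

text \<open>The operator S of the introduction: the constant term and \<open>slope v\<close> are the
  values of \<open>a\<close> and \<open>b\<close> that the two boundary conditions force.\<close>

definition linear_solution :: "(real \<Rightarrow> real) \<Rightarrow> real \<Rightarrow> real" where
  "linear_solution v t = (endpoint_defect v + slope v * \<Delta>\<^sub>3 / 2) / \<Delta>\<^sub>2 + slope v * t + RL_integral q v t"

lemma Gamma_pos: "Gamma (2 - \<sigma>) > 0" "Gamma (2 - \<nu>) > 0" "Gamma (q + 1) > 0" "Gamma (q + 2) > 0"
    "Gamma (q - \<sigma> + 1) > 0" "Gamma (q - \<nu> + 1) > 0"
  using q \<sigma> \<nu> by (auto intro!: Gamma_real_pos)

text \<open>Caputo derivatives annihilate the constant \<open>a\<close>, so this condition
  determines \<open>b\<close> alone; this makes the system triangular.\<close>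

lemma caputo_condition_iff:
  assumes v: "continuous_on {0..1} v"
    and x: "\<And>t. t \<in> {0..1} \<Longrightarrow> x t = a + b * t + RL_integral q v t"
  shows "caputo \<sigma> x \<xi> = (\<Sum>i=1..n. \<alpha> i * caputo \<nu> x (\<eta> i)) \<longleftrightarrow> b = slope v"
proof -
  define S where "S = (\<Sum>i=1..n. \<alpha> i * \<eta> i powr (1 - \<nu>))"
  define Q where "Q = (\<Sum>i=1..n. \<alpha> i * RL_integral (q - \<nu>) v (\<eta> i))"
  note G = Gamma_pos(1,2)
  have 1: "caputo \<sigma> x \<xi> = b * (\<xi> powr (1 - \<sigma>) / Gamma (2 - \<sigma>)) + RL_integral (q - \<sigma>) v \<xi>"
    by (rule caputo_affine_plus_RL_integral[OF q(1) \<sigma> v x \<xi>])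
  have "(\<Sum>i=1..n. \<alpha> i * caputo \<nu> x (\<eta> i))
      = (\<Sum>i=1..n. \<alpha> i * (b * (\<eta> i powr (1 - \<nu>) / Gamma (2 - \<nu>)) + RL_integral (q - \<nu>) v (\<eta> i)))"
    by (intro sum.cong refl arg_cong2[where f="(*)"] caputo_affine_plus_RL_integral[OF q(1) \<nu> v x \<eta>])
  also have "\<dots> = b * (S / Gamma (2 - \<nu>)) + Q"
    by (simp add: S_def Q_def sum.distrib sum_distrib_left sum_divide_distrib algebra_simps)
  finally have 2: "(\<Sum>i=1..n. \<alpha> i * caputo \<nu> x (\<eta> i)) = b * (S / Gamma (2 - \<nu>)) + Q" .
  have "b = slope v \<longleftrightarrow> b * \<Delta>\<^sub>1 = Gamma (2 - \<sigma>) * Gamma (2 - \<nu>) * (Q - RL_integral (q - \<sigma>) v \<xi>)"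
    using nz by (simp add: slope_def caputo_defect_def Q_def eq_divide_eq)
  \<comment> \<open>Multiplying by both Gamma values turns the coefficient of \<open>b\<close> into
    \<open>\<Delta>\<^sub>1\<close>.\<close>
  also have "\<dots> \<longleftrightarrow> b * (\<xi> powr (1 - \<sigma>) / Gamma (2 - \<sigma>)) + RL_integral (q - \<sigma>) v \<xi>
      = b * (S / Gamma (2 - \<nu>)) + Q"
    using G unfolding \<Delta>\<^sub>1 S_def[symmetric] by (simp add: field_simps)
  finally show ?thesis unfolding 1 2 by simp
qed

text \<open>With everything on one side, \<open>a\<close> has coefficient
  \<open>\<Delta>\<^sub>2\<close> and \<open>b\<close> has coefficient
  \<open>- \<Delta>\<^sub>3 / 2\<close>; the condition is then solved for \<open>a\<close>.\<close>

lemma endpoint_condition_iff: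
  assumes v: "continuous_on {0..1} v"
    and x: "\<And>t. t \<in> {0..1} \<Longrightarrow> x t = a + b * t + RL_integral q v t"
  shows "x 1 = (\<Sum>i=1..n. \<beta> i * integral {0..\<eta> i} x) + (\<Sum>i=1..n. \<gamma> i * x (\<eta> i))
    \<longleftrightarrow> a = (endpoint_defect v + b * \<Delta>\<^sub>3 / 2) / \<Delta>\<^sub>2"
proof -
  define R where "R = (\<Sum>i=1..n. \<beta> i * RL_integral (q + 1) v (\<eta> i) + \<gamma> i * RL_integral q v (\<eta> i))"
  have "(\<Sum>i=1..n. \<beta> i * integral {0..\<eta> i} x) + (\<Sum>i=1..n. \<gamma> i * x (\<eta> i))
      = (\<Sum>i=1..n. \<beta> i * integral {0..\<eta> i} x + \<gamma> i * x (\<eta> i))"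
    by (simp add: sum.distrib)
  also have "\<dots> = (\<Sum>i=1..n. a * (\<beta> i * \<eta> i + \<gamma> i) + b / 2 * (\<eta> i * (\<beta> i * \<eta> i + 2 * \<gamma> i))
        + (\<beta> i * RL_integral (q + 1) v (\<eta> i) + \<gamma> i * RL_integral q v (\<eta> i)))"
  proof (rule sum.cong)
    fix i assume "i \<in> {1..n}"
    then have \<eta>i: "\<eta> i \<in> {0..1}" using \<eta>[of i] by auto
    have "integral {0..\<eta> i} x = a * \<eta> i + b * ((\<eta> i)\<^sup>2 / 2) + RL_integral (q + 1) v (\<eta> i)"
      using q by (intro integral_affine_plus_RL_integral[OF _ v x \<eta>i]) auto
    then show "\<beta> i * integral {0..\<eta> i} x + \<gamma> i * x (\<eta> i)
      = a * (\<beta> i * \<eta> i + \<gamma> i) + b / 2 * (\<eta> i * (\<beta> i * \<eta> i + 2 * \<gamma> i))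
        + (\<beta> i * RL_integral (q + 1) v (\<eta> i) + \<gamma> i * RL_integral q v (\<eta> i))"
      by (simp add: x[OF \<eta>i] power2_eq_square algebra_simps)
  qed simp
  also have "\<dots> = a * (\<Sum>i=1..n. \<beta> i * \<eta> i + \<gamma> i)
      + b / 2 * (\<Sum>i=1..n. \<eta> i * (\<beta> i * \<eta> i + 2 * \<gamma> i)) + R"
    by (simp only: R_def sum_distrib_left sum.distrib[symmetric])
  also have "\<dots> = a * (1 - \<Delta>\<^sub>2) + b / 2 * (\<Delta>\<^sub>3 + 2) + R"
    unfolding \<Delta>\<^sub>2 \<Delta>\<^sub>3 by simp
  finally have rhs: "(\<Sum>i=1..n. \<beta> i * integral {0..\<eta> i} x) + (\<Sum>i=1..n. \<gamma> i * x (\<eta> i))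
      = a * (1 - \<Delta>\<^sub>2) + b / 2 * (\<Delta>\<^sub>3 + 2) + R" .
  have "a = (endpoint_defect v + b * \<Delta>\<^sub>3 / 2) / \<Delta>\<^sub>2 \<longleftrightarrow> a * \<Delta>\<^sub>2 = R - RL_integral q v 1 + b * \<Delta>\<^sub>3 / 2"
    using nz by (simp add: endpoint_defect_def R_def eq_divide_eq)
  moreover have "x 1 = a + b + RL_integral q v 1" using x[of 1] by simp
  ultimately show ?thesis unfolding rhs by (auto simp: field_simps)
qed

lemma continuous_on_linear_solution:
  "continuous_on {0..1} v \<Longrightarrow> continuous_on {0..1} (linear_solution v)"
  unfolding linear_solution_def[abs_def] using q
  by (intro continuous_intros continuous_on_RL_integral) auto

lemma bvp_solution_iff:
  assumes f: "continuous_on ({0..1} \<times> UNIV) (\<lambda>(t, x). f t x)"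
  shows "bvp_solution q \<sigma> \<nu> \<xi> n \<eta> \<alpha> \<beta> \<gamma> f x \<longleftrightarrow>
    continuous_on {0..1} x \<and> (\<forall>t\<in>{0..1}. x t = linear_solution (\<lambda>s. f s (x s)) t)"
    (is "?sol \<longleftrightarrow> ?fix")
\<comment> \<open>The linear lemmas need a continuous \<open>v\<close>, hence a continuous
  \<open>x\<close>. If \<open>x\<close> is not continuous, both sides are false.\<close>
proof (cases "continuous_on {0..1} x")
  case False
  then show ?thesis using C1_01_imp_continuous_on by (auto simp: bvp_solution_def)
next
  case True
  define v where "v s = f s (x s)" for s
  have v: "continuous_on {0..1} v"
    unfolding v_def[abs_def] by (rule continuous_on_superposition[OF f True])
  have fixp: "?fix \<longleftrightarrow> (\<forall>t\<in>{0..1}. x t = linear_solution v t)"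
    using True by (simp add: v_def[abs_def])
  show ?thesis
  proof
    assume s: ?sol
    then have "caputo_exists q x \<and> (\<forall>t\<in>{0..1}. caputo q x t = v t)"
      by (simp add: bvp_solution_def v_def)
    then obtain a b where x: "\<And>t. t \<in> {0..1} \<Longrightarrow> x t = a + b * t + RL_integral q v t"
      unfolding caputo_equation_iff[OF q v] by blast
    have "b = slope v" "a = (endpoint_defect v + b * \<Delta>\<^sub>3 / 2) / \<Delta>\<^sub>2"
      using s caputo_condition_iff[OF v x] endpoint_condition_iff[OF v x]
      unfolding bvp_solution_def by blast+
    then show ?fix unfolding fixp unfolding linear_solution_def using x by blast
  next
    assume ?fix
    then have x: "\<And>t. t \<in> {0..1} \<Longrightarrow> x t = (endpoint_defect v + slope v * \<Delta>\<^sub>3 / 2) / \<Delta>\<^sub>2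
        + slope v * t + RL_integral q v t"
      unfolding fixp unfolding linear_solution_def by blast
    then have "caputo_exists q x \<and> (\<forall>t\<in>{0..1}. caputo q x t = v t)"
      unfolding caputo_equation_iff[OF q v] by blast
    then show ?sol
      using caputo_condition_iff[OF v x] endpoint_condition_iff[OF v x]
      by (simp add: bvp_solution_def v_def caputo_exists_def)
  qed
qed

section \<open>Linearity and norm bound of the solution operator\<close>

text \<open>Linearity lets a bound on the operator, applied to a difference of right-hand sides,
  serve as a Lipschitz estimate.\<close>

lemma linear_solution_diff:
  assumes "continuous_on {0..1} v" "continuous_on {0..1} w" "t \<in> {0..1}"
  shows "linear_solution (\<lambda>s. v s - w s) t = linear_solution v t - linear_solution w t"
proof -
  have d: "RL_integral \<mu> (\<lambda>s. v s - w s) r = RL_integral \<mu> v r - RL_integral \<mu> w r"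
    if "\<mu> \<ge> 0" "r \<in> {0..1}" for \<mu> r
    using that by (intro RL_integral_diff continuous_on_subset[OF assms(1)] continuous_on_subset[OF assms(2)]) auto
  have \<eta>': "\<eta> i \<in> {0..1}" if "i \<in> {1..n}" for i using \<eta>[OF that] by simp
  have c: "caputo_defect (\<lambda>s. v s - w s) = caputo_defect v - caputo_defect w"
    unfolding caputo_defect_def using q \<sigma> \<nu> \<xi> \<eta>'
    by (simp add: d sum_subtractf right_diff_distrib cong: sum.cong_simp)
  have e: "endpoint_defect (\<lambda>s. v s - w s) = endpoint_defect v - endpoint_defect w"
    unfolding endpoint_defect_def using q \<eta>'
    by (simp add: d sum_subtractf sum.distrib right_diff_distrib cong: sum.cong_simp)
  have s: "slope (\<lambda>s. v s - w s) = slope v - slope w"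
    unfolding slope_def c by (simp add: right_diff_distrib)
  show ?thesis
    unfolding linear_solution_def s e using assms(3) q
    by (simp add: d add_divide_distrib diff_divide_distrib algebra_simps)
qed

text \<open>The factor of \<open>M\<close> is the last bracket of \<open>\<Theta>\<close>, obtained
  by bounding each fractional integral separately.\<close>

lemma caputo_defect_bound:
  assumes v: "continuous_on {0..1} v" and M: "\<And>s. s \<in> {0..1} \<Longrightarrow> \<bar>v s\<bar> \<le> M"
  shows "\<bar>caputo_defect v\<bar> \<le> M * (\<xi> powr (q - \<sigma>) / Gamma (q - \<sigma> + 1)
             + (\<Sum>i=1..n. \<bar>\<alpha> i\<bar> * (\<eta> i powr (q - \<nu>) / Gamma (q - \<nu> + 1))))"
proof -
  have b: "\<bar>RL_integral \<mu> v r\<bar> \<le> M * (r powr \<mu> / Gamma (\<mu> + 1))" if "\<mu> > 0" "r \<in> {0<..1}" for \<mu> r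
    using that M by (intro RL_integral_bound continuous_on_subset[OF v]) auto
  have "\<bar>\<Sum>i=1..n. \<alpha> i * RL_integral (q - \<nu>) v (\<eta> i)\<bar>
      \<le> (\<Sum>i=1..n. \<bar>\<alpha> i\<bar> * (M * (\<eta> i powr (q - \<nu>) / Gamma (q - \<nu> + 1))))"
  proof (intro order.trans[OF sum_abs] sum_mono)
    fix i assume "i \<in> {1..n}"
    then have "\<bar>RL_integral (q - \<nu>) v (\<eta> i)\<bar> \<le> M * (\<eta> i powr (q - \<nu>) / Gamma (q - \<nu> + 1))"
      using q \<nu> \<eta> by (intro b) auto
    then show "\<bar>\<alpha> i * RL_integral (q - \<nu>) v (\<eta> i)\<bar>
        \<le> \<bar>\<alpha> i\<bar> * (M * (\<eta> i powr (q - \<nu>) / Gamma (q - \<nu> + 1)))"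
      unfolding abs_mult by (rule mult_left_mono) simp
  qed
  moreover have "\<bar>RL_integral (q - \<sigma>) v \<xi>\<bar> \<le> M * (\<xi> powr (q - \<sigma>) / Gamma (q - \<sigma> + 1))"
    using q \<sigma> \<xi> by (intro b) auto
  ultimately show ?thesis
    unfolding caputo_defect_def by (simp add: distrib_left sum_distrib_left mult.left_commute)
qed

lemma endpoint_defect_bound:
  assumes v: "continuous_on {0..1} v" and M: "\<And>s. s \<in> {0..1} \<Longrightarrow> \<bar>v s\<bar> \<le> M"
  shows "\<bar>endpoint_defect v\<bar>
    \<le> M * ((1 + q + (\<Sum>i=1..n. \<eta> i powr q * (\<eta> i * \<bar>\<beta> i\<bar> + (q + 1) * \<bar>\<gamma> i\<bar>))) / Gamma (q + 2))"
proof -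
  have b: "\<bar>RL_integral \<mu> v r\<bar> \<le> M * (r powr \<mu> / Gamma (\<mu> + 1))" if "\<mu> > 0" "r \<in> {0<..1}" for \<mu> r
    using that M by (intro RL_integral_bound continuous_on_subset[OF v]) auto
  have G: "Gamma (q + 2) = (q + 1) * Gamma (q + 1)"
    using Gamma_plus1[of "q + 1"] q by (auto simp: nonpos_Ints_def add.assoc)
  \<comment> \<open>The integrals of orders \<open>q\<close> and \<open>q + 1\<close> are put over
    the common denominator \<open>Gamma (q + 2)\<close>; this is the origin of the factors
    \<open>q + 1\<close> in \<open>\<Theta>\<close>.\<close>
  have Gq: "1 / Gamma (q + 1) = (q + 1) / Gamma (q + 2)"
    unfolding G using q by simp
  have t: "\<bar>\<beta> i * RL_integral (q + 1) v (\<eta> i) + \<gamma> i * RL_integral q v (\<eta> i)\<bar>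
      \<le> M * (\<eta> i powr q * (\<eta> i * \<bar>\<beta> i\<bar> + (q + 1) * \<bar>\<gamma> i\<bar>) / Gamma (q + 2))" if i: "i \<in> {1..n}" for i
  proof -
    have 1: "\<bar>RL_integral (q + 1) v (\<eta> i)\<bar> \<le> M * (\<eta> i powr q * \<eta> i / Gamma (q + 2))"
      using b[of "q + 1" "\<eta> i"] q \<eta>[OF i] by (simp add: powr_add add.assoc)
    have 2: "\<bar>RL_integral q v (\<eta> i)\<bar> \<le> M * (\<eta> i powr q * ((q + 1) / Gamma (q + 2)))"
      using b[of q "\<eta> i"] q \<eta>[OF i] Gq by (simp add: divide_inverse)
    have "\<bar>\<beta> i * RL_integral (q + 1) v (\<eta> i) + \<gamma> i * RL_integral q v (\<eta> i)\<bar>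
        \<le> \<bar>\<beta> i\<bar> * \<bar>RL_integral (q + 1) v (\<eta> i)\<bar> + \<bar>\<gamma> i\<bar> * \<bar>RL_integral q v (\<eta> i)\<bar>"
      by (simp add: abs_mult[symmetric] abs_triangle_ineq)
    also have "\<dots> \<le> \<bar>\<beta> i\<bar> * (M * (\<eta> i powr q * \<eta> i / Gamma (q + 2)))
        + \<bar>\<gamma> i\<bar> * (M * (\<eta> i powr q * ((q + 1) / Gamma (q + 2))))"
      using 1 2 by (intro add_mono mult_left_mono) auto
    also have "\<dots> = M * (\<eta> i powr q * (\<eta> i * \<bar>\<beta> i\<bar> + (q + 1) * \<bar>\<gamma> i\<bar>) / Gamma (q + 2))"
      by (simp add: algebra_simps add_divide_distrib)
    finally show ?thesis .
  qed
  have "\<bar>\<Sum>i=1..n. \<beta> i * RL_integral (q + 1) v (\<eta> i) + \<gamma> i * RL_integral q v (\<eta> i)\<bar>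
      \<le> (\<Sum>i=1..n. M * (\<eta> i powr q * (\<eta> i * \<bar>\<beta> i\<bar> + (q + 1) * \<bar>\<gamma> i\<bar>) / Gamma (q + 2)))"
    using t by (intro order.trans[OF sum_abs] sum_mono)
  also have "\<dots> = M * ((\<Sum>i=1..n. \<eta> i powr q * (\<eta> i * \<bar>\<beta> i\<bar> + (q + 1) * \<bar>\<gamma> i\<bar>)) / Gamma (q + 2))"
    by (simp only: sum_distrib_left sum_divide_distrib)
  finally have s: "\<bar>\<Sum>i=1..n. \<beta> i * RL_integral (q + 1) v (\<eta> i) + \<gamma> i * RL_integral q v (\<eta> i)\<bar>
      \<le> M * ((\<Sum>i=1..n. \<eta> i powr q * (\<eta> i * \<bar>\<beta> i\<bar> + (q + 1) * \<bar>\<gamma> i\<bar>)) / Gamma (q + 2))" .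
  have e: "\<bar>RL_integral q v 1\<bar> \<le> M * ((1 + q) / Gamma (q + 2))"
    using b[of q 1] q Gq by (simp add: divide_inverse add.commute)
  have "\<bar>endpoint_defect v\<bar> \<le> M * ((1 + q) / Gamma (q + 2))
      + M * ((\<Sum>i=1..n. \<eta> i powr q * (\<eta> i * \<bar>\<beta> i\<bar> + (q + 1) * \<bar>\<gamma> i\<bar>)) / Gamma (q + 2))"
    unfolding endpoint_defect_def using s e by linarith
  then show ?thesis by (simp add: add_divide_distrib distrib_left)
qed

text \<open>The three summands of \<open>\<Theta>\<close> bound, in order, the fractional integral
  of \<open>v\<close>, the endpoint defect divided by \<open>\<Delta>\<^sub>2\<close>, and all terms
  containing the slope.\<close>

lemma linear_solution_bound:
  assumes v: "continuous_on {0..1} v" and M: "\<And>s. s \<in> {0..1} \<Longrightarrow> \<bar>v s\<bar> \<le> M" and t: "t \<in> {0..1}"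
  shows "\<bar>linear_solution v t\<bar> \<le> \<Theta> * M"
proof -
  define A where "A = \<xi> powr (q - \<sigma>) / Gamma (q - \<sigma> + 1)
             + (\<Sum>i=1..n. \<bar>\<alpha> i\<bar> * (\<eta> i powr (q - \<nu>) / Gamma (q - \<nu> + 1)))"
  define B where "B = 1 + q + (\<Sum>i=1..n. \<eta> i powr q * (\<eta> i * \<bar>\<beta> i\<bar> + (q + 1) * \<bar>\<gamma> i\<bar>))"
  define g where "g = Gamma (2 - \<sigma>) * Gamma (2 - \<nu>)"
  have g: "g > 0" using Gamma_pos by (simp add: g_def)
  have M0: "M \<ge> 0" using M[of 0] by simp
  have A: "\<bar>slope v\<bar> \<le> g / \<bar>\<Delta>\<^sub>1\<bar> * (M * A)"
  proof -
    have "\<bar>slope v\<bar> = g / \<bar>\<Delta>\<^sub>1\<bar> * \<bar>caputo_defect v\<bar>"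
      using g by (simp add: slope_def g_def[symmetric] abs_mult abs_divide)
    also have "\<dots> \<le> g / \<bar>\<Delta>\<^sub>1\<bar> * (M * A)"
      using caputo_defect_bound[OF v M] g unfolding A_def by (intro mult_left_mono) auto
    finally show ?thesis .
  qed
  have B: "\<bar>endpoint_defect v\<bar> / \<bar>\<Delta>\<^sub>2\<bar> \<le> M * (B / Gamma (q + 2)) / \<bar>\<Delta>\<^sub>2\<bar>"
    using endpoint_defect_bound[OF v M] unfolding B_def[symmetric] by (intro divide_right_mono) auto
  have R: "\<bar>RL_integral q v t\<bar> \<le> M * (1 / Gamma (q + 1))"
  proof -
    have "\<bar>RL_integral q v t\<bar> \<le> M * (t powr q / Gamma (q + 1))"
      using q t M by (intro RL_integral_bound continuous_on_subset[OF v]) auto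
    also have "\<dots> \<le> M * (1 / Gamma (q + 1))"
      using t q M0 Gamma_pos by (intro mult_left_mono divide_right_mono powr_le1) auto
    finally show ?thesis .
  qed
  \<comment> \<open>This is the total coefficient of \<open>slope v\<close>, which occurs both in
    the constant term and in the linear term.\<close>
  have T: "\<bar>t + \<Delta>\<^sub>3 / (2 * \<Delta>\<^sub>2)\<bar> \<le> (\<bar>\<Delta>\<^sub>3\<bar> + 2 * \<bar>\<Delta>\<^sub>2\<bar>) / (2 * \<bar>\<Delta>\<^sub>2\<bar>)"
  proof -
    have "\<bar>t + \<Delta>\<^sub>3 / (2 * \<Delta>\<^sub>2)\<bar> \<le> 1 + \<bar>\<Delta>\<^sub>3\<bar> / (2 * \<bar>\<Delta>\<^sub>2\<bar>)"
      using t abs_triangle_ineq[of t "\<Delta>\<^sub>3 / (2 * \<Delta>\<^sub>2)"] by (simp add: abs_divide abs_mult)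
    also have "\<dots> = (\<bar>\<Delta>\<^sub>3\<bar> + 2 * \<bar>\<Delta>\<^sub>2\<bar>) / (2 * \<bar>\<Delta>\<^sub>2\<bar>)" using nz by (simp add: field_simps)
    finally show ?thesis .
  qed
  have "linear_solution v t
      = endpoint_defect v / \<Delta>\<^sub>2 + slope v * (t + \<Delta>\<^sub>3 / (2 * \<Delta>\<^sub>2)) + RL_integral q v t"
    using nz by (simp add: linear_solution_def field_simps)
  then have "\<bar>linear_solution v t\<bar>
      \<le> \<bar>endpoint_defect v\<bar> / \<bar>\<Delta>\<^sub>2\<bar> + \<bar>slope v\<bar> * \<bar>t + \<Delta>\<^sub>3 / (2 * \<Delta>\<^sub>2)\<bar> + \<bar>RL_integral q v t\<bar>"
    unfolding abs_divide[symmetric] abs_mult[symmetric] by linarith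
  also have "\<dots> \<le> M * (B / Gamma (q + 2)) / \<bar>\<Delta>\<^sub>2\<bar>
      + g / \<bar>\<Delta>\<^sub>1\<bar> * (M * A) * ((\<bar>\<Delta>\<^sub>3\<bar> + 2 * \<bar>\<Delta>\<^sub>2\<bar>) / (2 * \<bar>\<Delta>\<^sub>2\<bar>)) + M * (1 / Gamma (q + 1))"
    by (intro add_mono mult_mono A B R T order.trans[OF abs_ge_zero A]) auto
  also have "\<dots> = \<Theta> * M"
    unfolding \<Theta> A_def[symmetric] B_def[symmetric] g_def[symmetric] abs_mult
    by (simp add: algebra_simps add_divide_distrib)
  finally show ?thesis .
qed

text \<open>The norm bound for the constant function 1 puts an absolute value below
  \<open>\<Theta>\<close>, so no sign of a summand has to be checked.\<close>

lemma \<Theta>_nonneg: "\<Theta> \<ge> 0"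
  using linear_solution_bound[of "\<lambda>_. 1" 1 0] by fastforce

end

section \<open>Existence and uniqueness by contraction\<close>

theorem theorem3p1:
  fixes q \<sigma> \<nu> \<xi> L \<Delta>\<^sub>1 \<Delta>\<^sub>2 \<Delta>\<^sub>3 \<Theta> :: real
    and n :: nat
    and \<eta> \<alpha> \<beta> \<gamma> :: "nat \<Rightarrow> real"
    and f :: "real \<Rightarrow> real \<Rightarrow> real"
  assumes q: "1 < q" "q \<le> 2"
    and \<sigma>: "0 < \<sigma>" "\<sigma> \<le> 1"
    and \<nu>: "0 < \<nu>" "\<nu> \<le> 1"
    and n: "n \<ge> 1"
    and \<xi>: "0 < \<xi>" "\<xi> < \<eta> 1"
    and \<eta>: "strict_mono_on {1..n} \<eta>" "\<eta> n < 1"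
    and \<Delta>\<^sub>1: "\<Delta>\<^sub>1 = \<xi> powr (1 - \<sigma>) * Gamma (2 - \<nu>)
               - Gamma (2 - \<sigma>) * (\<Sum>i=1..n. \<alpha> i * \<eta> i powr (1 - \<nu>))"
    and \<Delta>\<^sub>2: "\<Delta>\<^sub>2 = 1 - (\<Sum>i=1..n. \<beta> i * \<eta> i + \<gamma> i)"
    and \<Delta>\<^sub>3: "\<Delta>\<^sub>3 = - 2 + (\<Sum>i=1..n. \<eta> i * (\<beta> i * \<eta> i + 2 * \<gamma> i))"
    and nz: "\<Delta>\<^sub>1 \<noteq> 0" "\<Delta>\<^sub>2 \<noteq> 0"
    and \<Theta>: "\<Theta> = 1 / Gamma (q + 1)
        + 1 / (\<bar>\<Delta>\<^sub>2\<bar> * Gamma (q + 2))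
          * (1 + q + (\<Sum>i=1..n. \<eta> i powr q * (\<eta> i * \<bar>\<beta> i\<bar> + (q + 1) * \<bar>\<gamma> i\<bar>)))
        + Gamma (2 - \<sigma>) * Gamma (2 - \<nu>) * (\<bar>\<Delta>\<^sub>3\<bar> + 2 * \<bar>\<Delta>\<^sub>2\<bar>) / (2 * \<bar>\<Delta>\<^sub>1 * \<Delta>\<^sub>2\<bar>)
          * (\<xi> powr (q - \<sigma>) / Gamma (q - \<sigma> + 1)
             + (\<Sum>i=1..n. \<bar>\<alpha> i\<bar> * (\<eta> i powr (q - \<nu>) / Gamma (q - \<nu> + 1))))"
    and f_cont: "continuous_on ({0..1} \<times> UNIV) (\<lambda>(t, x). f t x)"
    and L: "L > 0"
    and f_lip: "\<And>t x y. t \<in> {0..1} \<Longrightarrow> \<bar>f t x - f t y\<bar> \<le> L * \<bar>x - y\<bar>"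
    and contr: "L * \<Theta> < 1"
  shows "\<exists>x. bvp_solution q \<sigma> \<nu> \<xi> n \<eta> \<alpha> \<beta> \<gamma> f x \<and>
             (\<forall>y. bvp_solution q \<sigma> \<nu> \<xi> n \<eta> \<alpha> \<beta> \<gamma> f y \<longrightarrow> (\<forall>t\<in>{0..1}. y t = x t))"
proof -
  \<comment> \<open>Together with \<open>0 < \<xi> < \<eta> 1\<close> and
    \<open>\<eta> n < 1\<close> this places every node in the interval that the locale asks
    for.\<close>
  have \<eta>_bounds: "\<eta> 1 \<le> \<eta> i \<and> \<eta> i \<le> \<eta> n" if "i \<in> {1..n}" for i
    using strict_mono_on_leD[OF \<eta>(1)] that n by auto
  interpret multipoint_bvp q \<sigma> \<nu> \<xi> \<Delta>\<^sub>1 \<Delta>\<^sub>2 \<Delta>\<^sub>3 \<Theta> n \<eta> \<alpha> \<beta> \<gamma>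
  proof
    show "\<xi> \<in> {0<..1}" using \<xi> \<eta>(2) \<eta>_bounds[of 1] n by auto
    show "\<eta> i \<in> {0<..1}" if "i \<in> {1..n}" for i using \<xi> \<eta>(2) \<eta>_bounds[OF that] by auto
  qed (fact q \<sigma> \<nu> \<Delta>\<^sub>1 \<Delta>\<^sub>2 \<Delta>\<^sub>3 nz \<Theta>)+
  have F: "continuous_on {0..1} (\<lambda>s. f s (u s))" if "continuous_on {0..1} u" for u
    by (rule continuous_on_superposition[OF f_cont that])
  have cont: "continuous_on {0..1} (linear_solution (\<lambda>s. f s (u s)))" if "continuous_on {0..1} u" for u
    using that by (intro continuous_on_linear_solution F)
  have lip: "\<bar>linear_solution (\<lambda>s. f s (u s)) t - linear_solution (\<lambda>s. f s (w s)) t\<bar> \<le> L * \<Theta> * M"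
    if u: "continuous_on {0..1} u" and w: "continuous_on {0..1} w"
      and M: "\<And>s. s \<in> {0..1} \<Longrightarrow> \<bar>u s - w s\<bar> \<le> M" and t: "t \<in> {0..1}" for u w M t
  proof -
    have "\<bar>f s (u s) - f s (w s)\<bar> \<le> L * M" if "s \<in> {0..1}" for s
      using f_lip[OF that, of "u s" "w s"] mult_left_mono[OF M[OF that], of L] L by linarith
    then have "\<bar>linear_solution (\<lambda>s. f s (u s) - f s (w s)) t\<bar> \<le> \<Theta> * (L * M)"
      using t by (intro linear_solution_bound continuous_on_diff F u w)
    then show ?thesis using linear_solution_diff[OF F[OF u] F[OF w] t] by (simp add: mult_ac)
  qed
  have k: "0 \<le> L * \<Theta>" using L \<Theta>_nonneg by simp
  show ?thesis
  proof (rule contraction_on_continuous_functions_Icc[OF zero_le_one k contr,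
        where T = "\<lambda>u. linear_solution (\<lambda>s. f s (u s))"])
    fix x assume "continuous_on {0..1} x" "\<And>t. t \<in> {0..1} \<Longrightarrow> x t = linear_solution (\<lambda>s. f s (x s)) t"
      "\<And>y t. continuous_on {0..1} y \<Longrightarrow> (\<And>t. t \<in> {0..1} \<Longrightarrow> y t = linear_solution (\<lambda>s. f s (y s)) t)
        \<Longrightarrow> t \<in> {0..1} \<Longrightarrow> y t = x t"
    \<comment> \<open>Solutions are exactly the continuous fixed points, so both existence and
      uniqueness carry over.\<close>
    then show ?thesis unfolding bvp_solution_iff[OF f_cont] by blast
  qed (fact cont lip)+
qed

end
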